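(* Let $N$ be a (bounded) normal operator on a separable complex Hilbert space. Then $N$ is not Li-Yorke chaotic. Consequently, $N$ is neither distributionally chaotic nor norm-unimodal.
   Context: Let $f:X\to X$ be a continuous map on a metric space $(X,d)$; for an operator on a Hilbert space, $d(x,y)=\|x-y\|$. Li-Yorke chaos: a pair $\{x,y\}\subset X$ is a Li-Yorke chaotic pair if $\limsup_{n\to\infty}d(f^n(x),f^n(y))>0$ and $\liminf_{n\to\infty}d(f^n(x),f^n(y))=0$. The map $f$ is Li-Yorke chaotic if there is an uncountable subset $\Gamma\subseteq X$ such that every pair of two distinct points of $\Gamma$ is a Li-Yorke chaotic pair. Distributional chaos: for $x,y\in X$, $n\ge 1$ and $\tau\in\mathbb{R}$, put $F^{n}_{xy}(\tau)=\frac1n\#\{0\le i\le n-1: d(f^i(x),f^i(y))<\tau\}$, $F_{xy}(\tau)=\liminf_{n\to\infty}F^n_{xy}(\tau)$ and $F^*_{xy}(\tau)=\limsup_{n\to\infty}F^n_{xy}(\tau)$. The pair $\{x,y\}$ is distributionally chaotic if $F^*_{xy}(\tau)=1$ for all $\tau>0$ and $F_{xy}(\epsilon)=0$ for some $\epsilon>0$. The map $f$ is distributionally chaotic if there is an uncountable subset $\Lambda\subseteq X$ such that every pair of two distinct points of $\Lambda$ is a distributionally chaotic pair. Norm-unimodality: a bounded linear operator $T$ on a Banach space $X$ is norm-unimodal if there is a constant $r>1$ such that for every $m\in\mathbb{N}$ there exists a nonzero vector $x_m\in X$ satisfying $\lim_{k\to\infty}\|T^k x_m\|=0$ and $\|T^i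 x_m\|\ge r^i\|x_m\|$ for $i=1,2,\ldots,m$. *)

theory Defs
  imports "HOL-Analysis.Analysis"
begin

section \<open>Complex Hilbert spaces\<close>

text \<open>
  Every complex normed space is in particular a real normed space, so the class extends
  \<^class>\<open>real_normed_vector\<close>, whose norm, metric and topology are used throughout; the axiom
  \<open>scaleR_scaleC\<close> says that its real scalar multiplication is the restriction of the complex one.
  The inner product is linear in the first argument.
\<close>

class complex_inner = real_normed_vector +
  fixes scaleC :: "complex \<Rightarrow> 'a \<Rightarrow> 'a"  (infixr \<open>*\<^sub>C\<close> 75)
    and cinner :: "'a \<Rightarrow> 'a \<Rightarrow> complex"
  assumes scaleC_add_right: "a *\<^sub>C (x + y) = a *\<^sub>C x + a *\<^sub>C y"
    and scaleC_add_left: "(a + b) *\<^sub>C x = a *\<^sub>C x + b *\<^sub>C x"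
    and scaleC_scaleC: "a *\<^sub>C (b *\<^sub>C x) = (a * b) *\<^sub>C x"
    and scaleC_one: "1 *\<^sub>C x = x"
    and scaleR_scaleC: "scaleR r x = complex_of_real r *\<^sub>C x"
    and cinner_commute: "cinner x y = cnj (cinner y x)"
    and cinner_add_left: "cinner (x + y) z = cinner x z + cinner y z"
    and cinner_scaleC_left: "cinner (a *\<^sub>C x) y = a * cinner x y"
    and cinner_self: "cinner x x = complex_of_real ((norm x)\<^sup>2)"

class chilbert_space = complex_inner + banach

instantiation complex :: chilbert_space
begin

definition scaleC_complex :: "complex \<Rightarrow> complex \<Rightarrow> complex"
  where "scaleC_complex a x = a * x"

definition cinner_complex :: "complex \<Rightarrow> complex \<Rightarrow> complex"
  where "cinner_complex x y = x * cnj y"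

instance
proof
  fix x :: complex
  show "cinner x x = complex_of_real ((norm x)\<^sup>2)"
    unfolding cinner_complex_def by (rule complex_norm_square [symmetric])
qed (simp_all add: scaleC_complex_def cinner_complex_def distrib_left distrib_right
  scaleR_conv_of_real)

end


section \<open>Bounded normal operators\<close>

definition bounded_clinear :: "('a::complex_inner \<Rightarrow> 'b::complex_inner) \<Rightarrow> bool"
  where "bounded_clinear T \<longleftrightarrow> bounded_linear T \<and> (\<forall>c x. T (c *\<^sub>C x) = c *\<^sub>C T x)"

text \<open>
  On a Hilbert space the adjoint of a bounded operator exists by the Riesz representation
  theorem, and it is always unique, so the choice operator makes no real choice
  (compare \<^const>\<open>adjoint\<close> for real inner products).
\<close>

definition cadjoint :: "('a::complex_inner \<Rightarrow> 'b::complex_inner) \<Rightarrow> 'b \<Rightarrow> 'a"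
  where "cadjoint T = (SOME S. \<forall>x y. cinner (T x) y = cinner x (S y))"

definition normal_operator :: "('a::chilbert_space \<Rightarrow> 'a) \<Rightarrow> bool"
  where "normal_operator T \<longleftrightarrow> bounded_clinear T \<and> T \<circ> cadjoint T = cadjoint T \<circ> T"


section \<open>Chaos\<close>

text \<open>Upper and lower limits are taken in \<^typ>\<open>ereal\<close>, since distances along orbits may be unbounded.\<close>

definition Li_Yorke_pair :: "('a::metric_space \<Rightarrow> 'a) \<Rightarrow> 'a \<Rightarrow> 'a \<Rightarrow> bool"
  where "Li_Yorke_pair f x y \<longleftrightarrow>
    limsup (\<lambda>n. ereal (dist ((f ^^ n) x) ((f ^^ n) y))) > 0 \<and>
    liminf (\<lambda>n. ereal (dist ((f ^^ n) x) ((f ^^ n) y))) = 0"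

definition Li_Yorke_chaotic :: "('a::metric_space \<Rightarrow> 'a) \<Rightarrow> bool"
  where "Li_Yorke_chaotic f \<longleftrightarrow>
    (\<exists>\<Gamma>. uncountable \<Gamma> \<and> (\<forall>x\<in>\<Gamma>. \<forall>y\<in>\<Gamma>. x \<noteq> y \<longrightarrow> Li_Yorke_pair f x y))"

definition distr_fun :: "('a::metric_space \<Rightarrow> 'a) \<Rightarrow> 'a \<Rightarrow> 'a \<Rightarrow> nat \<Rightarrow> real \<Rightarrow> real"
  where "distr_fun f x y n \<tau> =
    real (card {i. i < n \<and> dist ((f ^^ i) x) ((f ^^ i) y) < \<tau>}) / real n"

definition lower_distr_fun :: "('a::metric_space \<Rightarrow> 'a) \<Rightarrow> 'a \<Rightarrow> 'a \<Rightarrow> real \<Rightarrow> ereal"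
  where "lower_distr_fun f x y \<tau> = liminf (\<lambda>n. ereal (distr_fun f x y n \<tau>))"

definition upper_distr_fun :: "('a::metric_space \<Rightarrow> 'a) \<Rightarrow> 'a \<Rightarrow> 'a \<Rightarrow> real \<Rightarrow> ereal"
  where "upper_distr_fun f x y \<tau> = limsup (\<lambda>n. ereal (distr_fun f x y n \<tau>))"

definition distr_chaotic_pair :: "('a::metric_space \<Rightarrow> 'a) \<Rightarrow> 'a \<Rightarrow> 'a \<Rightarrow> bool"
  where "distr_chaotic_pair f x y \<longleftrightarrow>
    (\<forall>\<tau>>0. upper_distr_fun f x y \<tau> = 1) \<and> (\<exists>\<epsilon>>0. lower_distr_fun f x y \<epsilon> = 0)"

definition distributionally_chaotic :: "('a::metric_space \<Rightarrow> 'a) \<Rightarrow> bool"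
  where "distributionally_chaotic f \<longleftrightarrow>
    (\<exists>\<Lambda>. uncountable \<Lambda> \<and> (\<forall>x\<in>\<Lambda>. \<forall>y\<in>\<Lambda>. x \<noteq> y \<longrightarrow> distr_chaotic_pair f x y))"

definition norm_unimodal :: "('a::banach \<Rightarrow> 'a) \<Rightarrow> bool"
  where "norm_unimodal T \<longleftrightarrow>
    (\<exists>r>1. \<forall>m::nat. \<exists>x. x \<noteq> 0 \<and>
      (\<lambda>k. norm ((T ^^ k) x)) \<longlonglongrightarrow> 0 \<and>
      (\<forall>i\<in>{1..m}. norm ((T ^^ i) x) \<ge> r ^ i * norm x))"

end

theory Submission
  imports Defs
begin

text \<open>
  If \<open>N\<close> is normal then \<open>\<parallel>N\<^sup>* z\<parallel> = \<parallel>N z\<parallel>\<close>, so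
  \<open>\<parallel>N z\<parallel>\<^sup>2 = \<langle>N\<^sup>* N z, z\<rangle> \<le> \<parallel>N (N z)\<parallel> \<parallel>z\<parallel>\<close> and every sequence of norms \<open>\<parallel>N\<^sup>n z\<parallel>\<close> is log-convex.
  A nonnegative log-convex sequence either decreases to \<open>0\<close> or is eventually bounded away from
  \<open>0\<close>. Chaotic pairs would need an orbit difference that is neither, and a norm-unimodal operator
  one that tends to \<open>0\<close> after an initial increase.
\<close>

section \<open>Log-convex sequences\<close>

text \<open>Convexity propagates an increase: after \<open>a m < a (Suc m)\<close> no later step
  goes down, so the positive value \<open>a (Suc m)\<close> is a lower bound. Without an increase
  there is a limit, which is either 0 or itself a positive lower bound.\<close>

lemma log_convex_cases:
  fixes a :: "nat \<Rightarrow> real"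
  assumes nonneg: "\<And>n. 0 \<le> a n"
    and convex: "\<And>n. (a (Suc n))\<^sup>2 \<le> a n * a (Suc (Suc n))"
  obtains "decseq a" "a \<longlonglongrightarrow> 0"
  | c where "c > 0" "\<forall>\<^sub>F n in sequentially. c \<le> a n"
proof (cases "decseq a")
  case True
  then obtain L where L: "a \<longlonglongrightarrow> L"
    using decseq_convergent[of a 0] nonneg by blast
  then have "\<forall>n. L \<le> a n"
    using True decseq_ge by blast
  moreover have "0 \<le> L"
    using L nonneg by (simp add: LIMSEQ_le_const)
  ultimately show thesis
    using that(1)[OF True] that(2)[of L] L
    by (cases "L = 0") (auto intro: always_eventually)
next
  case False
  then obtain m where m: "a m < a (Suc m)"
    by (auto simp: decseq_Suc_iff not_le)
  have grow: "a (Suc n) \<le> a (Suc (Suc n))" if "a n \<le> a (Suc n)" "0 < a (Suc n)" for n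
  proof -
    have "(a (Suc n))\<^sup>2 \<le> a (Suc n) * a (Suc (Suc n))"
      using convex[of n] mult_right_mono[OF that(1) nonneg] by (meson order_trans)
    then show ?thesis
      using that(2) by (simp add: power2_eq_square)
  qed
  \<comment> \<open>The lower bound is carried through the induction because it supplies the
    positivity by which \<open>grow\<close> cancels \<open>a (Suc n)\<close>.\<close>
  have "a (Suc m) \<le> a (Suc n) \<and> a n \<le> a (Suc n)" if "n \<ge> m" for n
    using that
  proof (induction n rule: dec_induct)
    case (step n)
    then have "a (Suc n) \<le> a (Suc (Suc n))"
      using m nonneg[of m] by (intro grow) auto
    with step show ?case
      by auto
  qed (use m in auto)
  then have "a (Suc m) \<le> a n" if "n \<ge> Suc m" for n
    using that by (cases n) auto
  then have "\<forall>\<^sub>F n in sequentially. a (Suc m) \<le> a n"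
    by (rule eventually_sequentiallyI)
  moreover have "0 < a (Suc m)"
    using m nonneg[of m] by linarith
  ultimately show thesis
    using that(2) by blast
qed

section \<open>Adjoints of bounded operators\<close>

lemma cinner_add_right: "cinner x (y + z) = cinner x y + cinner x z"
  by (metis cinner_add_left cinner_commute complex_cnj_add)

lemma cinner_scaleR_left: "cinner (r *\<^sub>R x) y = of_real r * cinner x y"
  by (simp add: scaleR_scaleC cinner_scaleC_left)

lemma cinner_scaleR_right: "cinner x (r *\<^sub>R y) = of_real r * cinner x y"
  by (metis cinner_commute cinner_scaleR_left complex_cnj_complex_of_real complex_cnj_mult)

lemma norm_add_cinner:
  "(norm (x + y))\<^sup>2 = (norm x)\<^sup>2 + (norm y)\<^sup>2 + 2 * Re (cinner x y)"
proof -
  have "(norm (x + y))\<^sup>2 = Re (cinner (x + y) (x + y))"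
    by (simp add: cinner_self)
  also have "\<dots> = Re (cinner x x) + Re (cinner y y) + Re (cinner x y) + Re (cinner y x)"
    by (simp add: cinner_add_left cinner_add_right)
  also have "Re (cinner y x) = Re (cinner x y)"
    by (metis cinner_commute cnj.sel(1))
  finally show ?thesis
    by (simp add: cinner_self)
qed

text \<open>Squaring the triangle inequality and expanding both sides leaves this real part of
  Cauchy-Schwarz.\<close>

lemma Re_cinner_le: "Re (cinner x y) \<le> norm x * norm y"
proof -
  have "(norm (x + y))\<^sup>2 \<le> (norm x + norm y)\<^sup>2"
    by (simp add: norm_triangle_ineq)
  then show ?thesis
    by (simp add: norm_add_cinner power2_sum)
qed

lemma parallelogram:
  fixes x y :: "'a::complex_inner"
  shows "(norm (x + y))\<^sup>2 + (norm (x - y))\<^sup>2 = 2 * (norm x)\<^sup>2 + 2 * (norm y)\<^sup>2"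
  using norm_add_cinner[of x y] norm_add_cinner[of x "- y"] cinner_scaleR_right[of x "-1" y]
  by simp

section \<open>Riesz representation of real-valued functionals\<close>

lemma linear_coeff_eq_0:
  fixes b c :: real
  assumes "\<And>t. 0 \<le> 2 * t * b + t\<^sup>2 * c"
  shows "b = 0"
proof (rule ccontr)
  assume "b \<noteq> 0"
  \<comment> \<open>The sign makes the linear term negative; the denominator is positive and large
    enough for that term to outweigh the quadratic one.\<close>
  define t where "t = - b / (1 + \<bar>c\<bar>)"
  have "t * (1 + \<bar>c\<bar>) = - b"
    by (simp add: t_def add_pos_nonneg)
  then have b: "b = - t * (1 + \<bar>c\<bar>)"
    by simp
  have "2 * t * b + t\<^sup>2 * c = t\<^sup>2 * (c - 2 - 2 * \<bar>c\<bar>)"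
    by (simp add: b power2_eq_square algebra_simps)
  moreover have "t\<^sup>2 * (c - 2 - 2 * \<bar>c\<bar>) < 0"
    using \<open>b \<noteq> 0\<close> b by (intro mult_pos_neg) auto
  ultimately show False
    using assms[of t] by linarith
qed

text \<open>The representing vector minimises \<open>\<parallel>y\<parallel>\<^sup>2 - 2 \<phi> y\<close>.\<close>

lemma riesz_representation:
  fixes \<phi> :: "'a::chilbert_space \<Rightarrow> real"
  assumes "bounded_linear \<phi>"
  obtains w where "\<And>z. \<phi> z = Re (cinner z w)"
proof -
  interpret bounded_linear \<phi> by fact
  define J where "J y = (norm y)\<^sup>2 - 2 * \<phi> y" for y
  define d where "d = (INF y. J y)"
  obtain K where K: "\<And>y. norm (\<phi> y) \<le> norm y * K"
    using bounded by blast
  \<comment> \<open>Completing the square in \<open>norm y\<close> after bounding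
    \<open>\<phi> y\<close> by \<open>norm y * K\<close>.\<close>
  have "- K\<^sup>2 \<le> J y" for y
    using K[of y] zero_le_power2[of "norm y - K"]
    by (simp add: J_def power2_diff algebra_simps)
  then have bdd: "bdd_below (range J)"
    unfolding bdd_below_def by blast
  have d_le: "d \<le> J y" for y
    unfolding d_def by (rule cINF_lower[OF bdd]) simp
  have "\<exists>y. J y < d + inverse (real (Suc n))" for n
    using cINF_less_iff[OF _ bdd, of "d + inverse (real (Suc n))"] by (simp add: d_def)
  then obtain y where y: "\<And>n. J (y n) < d + inverse (real (Suc n))"
    by metis
  \<comment> \<open>The midpoint of \<open>u\<close> and \<open>v\<close> has \<open>J\<close> at
    least \<open>d\<close>, so by the parallelogram law two near-minimisers must be close. This
    makes the minimising sequence Cauchy.\<close>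
  have J_diff: "(norm (u - v))\<^sup>2 \<le> 2 * J u + 2 * J v - 4 * d" for u v
  proof -
    have "J ((1/2) *\<^sub>R (u + v)) = (norm (u + v))\<^sup>2 / 4 - (\<phi> u + \<phi> v)"
      by (simp add: J_def scale add power_divide add_divide_distrib del: scaleR_add_right)
    then show ?thesis
      using parallelogram[of u v] d_le[of "(1/2) *\<^sub>R (u + v)"] by (simp add: J_def)
  qed
  have "Cauchy y"
  proof (rule metric_CauchyI)
    fix e :: real
    assume "e > 0"
    then obtain M where M: "inverse (real (Suc M)) < e\<^sup>2 / 4"
      using reals_Archimedean[of "e\<^sup>2 / 4"] by auto
    have near: "J (y n) < d + e\<^sup>2 / 4" if "n \<ge> M" for n
    proof -
      have "inverse (real (Suc n)) \<le> inverse (real (Suc M))"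
        using that by (intro le_imp_inverse_le) auto
      then show ?thesis
        using y[of n] M by linarith
    qed
    have "dist (y m) (y n) < e" if "m \<ge> M" "n \<ge> M" for m n
    proof -
      have "(dist (y m) (y n))\<^sup>2 < e\<^sup>2"
        using J_diff[of "y m" "y n"] near[OF that(1)] near[OF that(2)]
        by (simp add: dist_norm)
      then show ?thesis
        using \<open>e > 0\<close> by (simp add: power_less_imp_less_base)
    qed
    then show "\<exists>M. \<forall>m\<ge>M. \<forall>n\<ge>M. dist (y m) (y n) < e"
      by blast
  qed
  then obtain w where w: "y \<longlonglongrightarrow> w"
    using Cauchy_convergent convergent_def by blast
  have "(\<lambda>n. J (y n)) \<longlonglongrightarrow> J w"
    unfolding J_def by (intro tendsto_intros tendsto w)
  moreover have "(\<lambda>n. d + inverse (real (Suc n))) \<longlonglongrightarrow> d"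
    using tendsto_add[OF tendsto_const LIMSEQ_inverse_real_of_nat] by simp
  ultimately have "J w \<le> d"
    using y by (meson LIMSEQ_le less_imp_le)
  have "\<phi> z = Re (cinner z w)" for z
  proof -
    \<comment> \<open>The right-hand side is \<open>J (t *\<^sub>R z + w) - J w\<close>: first
      variation at the minimiser \<open>w\<close> in direction \<open>z\<close>.\<close>
    have "0 \<le> 2 * t * (Re (cinner z w) - \<phi> z) + t\<^sup>2 * (norm z)\<^sup>2" for t
      using d_le[of "t *\<^sub>R z + w"] \<open>J w \<le> d\<close> norm_add_cinner[of "t *\<^sub>R z" w]
      by (simp add: J_def cinner_scaleR_left add scale power_mult_distrib algebra_simps)
    from linear_coeff_eq_0[OF this] show ?thesis
      by simp
  qed
  then show thesis
    by (rule that)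
qed

text \<open>This discharges the choice in \<open>cadjoint\<close>. For fixed \<open>y\<close>, Riesz
  represents the real part of \<open>cinner (T x) y\<close>; complex linearity recovers the
  imaginary part.\<close>

lemma cinner_cadjoint:
  fixes T :: "'a::chilbert_space \<Rightarrow> 'b::complex_inner"
  assumes "bounded_clinear T"
  shows "cinner (T x) y = cinner x (cadjoint T y)"
proof -
  interpret bounded_linear T
    using assms by (simp add: bounded_clinear_def)
  have "\<exists>w. \<forall>x. cinner (T x) y = cinner x w" for y
  proof -
    obtain K where K: "\<And>x. norm (T x) \<le> norm x * K"
      using bounded by blast
    have "bounded_linear (\<lambda>x. Re (cinner (T x) y))"
    proof (rule bounded_linear_intro)
      fix x
      have "Re (cinner (T x) y) \<le> norm x * K * norm y" for x
        using Re_cinner_le[of "T x" y] mult_right_mono[OF K norm_ge_zero] by (rule order_trans)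
      from this[of x] this[of "- x"]
      have "\<bar>Re (cinner (T x) y)\<bar> \<le> norm x * K * norm y"
        using cinner_scaleR_left[of "-1" "T x" y] by (simp add: neg)
      then show "norm (Re (cinner (T x) y)) \<le> norm x * (K * norm y)"
        by (simp add: mult.assoc)
    qed (simp_all add: add scale cinner_add_left cinner_scaleR_left)
    then obtain w where w: "\<And>x. Re (cinner (T x) y) = Re (cinner x w)"
      using riesz_representation[of "\<lambda>x. Re (cinner (T x) y)"] by metis
    \<comment> \<open>Multiplying the argument by the imaginary unit turns real parts into negated
      imaginary parts.\<close>
    have "Im (cinner (T x) y) = Im (cinner x w)" for x
      using w[of "\<i> *\<^sub>C x"] assms by (simp add: bounded_clinear_def cinner_scaleC_left)
    with w show ?thesis
      by (metis complex_eqI)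
  qed
  then have "\<exists>S. \<forall>x y. cinner (T x) y = cinner x (S y)"
    by metis
  from someI_ex[OF this] show ?thesis
    unfolding cadjoint_def by blast
qed

section \<open>Orbits of normal operators\<close>

text \<open>The two squared norms are the quadratic forms of \<open>N \<circ> cadjoint N\<close> and
  \<open>cadjoint N \<circ> N\<close> at \<open>z\<close>, which normality identifies.\<close>

lemma norm_cadjoint_normal:
  assumes "normal_operator N"
  shows "norm (cadjoint N z) = norm (N z)"
proof -
  note adj = cinner_cadjoint[of N]
  have N: "bounded_clinear N" and comm: "N (cadjoint N z) = cadjoint N (N z)"
    using assms by (auto simp: normal_operator_def fun_eq_iff)
  have "complex_of_real ((norm (cadjoint N z))\<^sup>2) = cinner (N (cadjoint N z)) z"
    by (simp only: adj[OF N] cinner_self)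
  also have "\<dots> = cnj (cinner z (cadjoint N (N z)))"
    using comm cinner_commute by metis
  also have "\<dots> = complex_of_real ((norm (N z))\<^sup>2)"
    by (simp add: adj[OF N, symmetric] cinner_self)
  finally have "(norm (cadjoint N z))\<^sup>2 = (norm (N z))\<^sup>2"
    using of_real_eq_iff by blast
  then show ?thesis
    by simp
qed

lemma norm_square_normal_le:
  assumes "normal_operator N"
  shows "(norm (N z))\<^sup>2 \<le> norm z * norm (N (N z))"
proof -
  have N: "bounded_clinear N"
    using assms by (simp add: normal_operator_def)
  have "(norm (N z))\<^sup>2 = Re (cinner z (cadjoint N (N z)))"
    by (simp add: cinner_cadjoint[OF N, symmetric] cinner_self)
  then show ?thesis
    using Re_cinner_le[of z "cadjoint N (N z)"] by (simp add: norm_cadjoint_normal[OF assms])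
qed

lemma normal_orbit_cases:
  assumes "normal_operator N"
  obtains "decseq (\<lambda>n. norm ((N ^^ n) z))" "(\<lambda>n. norm ((N ^^ n) z)) \<longlonglongrightarrow> 0"
  | c where "c > 0" "\<forall>\<^sub>F n in sequentially. c \<le> norm ((N ^^ n) z)"
  by (rule log_convex_cases[of "\<lambda>n. norm ((N ^^ n) z)"])
    (use norm_square_normal_le[OF assms] in auto)

text \<open>By linearity the distance between two orbits is the norm along the single orbit of
  \<open>x - y\<close>.\<close>

lemma normal_dist_cases:
  assumes "normal_operator N"
  obtains "(\<lambda>n. dist ((N ^^ n) x) ((N ^^ n) y)) \<longlonglongrightarrow> 0"
  | c where "c > 0" "\<forall>\<^sub>F n in sequentially. c \<le> dist ((N ^^ n) x) ((N ^^ n) y)"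
proof -
  have "linear N"
    using assms by (simp add: normal_operator_def bounded_clinear_def bounded_linear.linear)
  then have "(N ^^ n) x - (N ^^ n) y = (N ^^ n) (x - y)" for n
    by (induction n) (simp_all add: linear_diff[symmetric])
  then show thesis
    using normal_orbit_cases[OF assms, of "x - y" thesis] that by (simp add: dist_norm)
qed

section \<open>Chaotic pairs\<close>

lemma Li_Yorke_pair_not_tendsto_0:
  assumes "Li_Yorke_pair f x y"
  shows "\<not> (\<lambda>n. dist ((f ^^ n) x) ((f ^^ n) y)) \<longlonglongrightarrow> 0"
proof
  assume "(\<lambda>n. dist ((f ^^ n) x) ((f ^^ n) y)) \<longlonglongrightarrow> 0"
  then have "(\<lambda>n. ereal (dist ((f ^^ n) x) ((f ^^ n) y))) \<longlonglongrightarrow> ereal 0"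
    by (intro tendsto_ereal)
  from lim_imp_Limsup[OF sequentially_bot this] show False
    using assms by (simp add: Li_Yorke_pair_def)
qed

lemma Li_Yorke_pair_not_bounded_below:
  assumes "Li_Yorke_pair f x y" "c > 0"
  shows "\<not> (\<forall>\<^sub>F n in sequentially. c \<le> dist ((f ^^ n) x) ((f ^^ n) y))"
proof
  assume "\<forall>\<^sub>F n in sequentially. c \<le> dist ((f ^^ n) x) ((f ^^ n) y)"
  then have "ereal c \<le> liminf (\<lambda>n. ereal (dist ((f ^^ n) x) ((f ^^ n) y)))"
    by (intro Liminf_bounded) simp
  then show False
    using assms by (simp add: Li_Yorke_pair_def)
qed

section \<open>Asymptotic densities and distributional chaos\<close>

lemma density_tendsto_0:
  assumes "\<forall>\<^sub>F i in sequentially. \<not> P i"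
  shows "(\<lambda>n. real (card {i. i < n \<and> P i}) / real n) \<longlonglongrightarrow> 0"
proof -
  obtain K where K: "\<And>i. i \<ge> K \<Longrightarrow> \<not> P i"
    using assms by (auto simp: eventually_sequentially)
  have "card {i. i < n \<and> P i} \<le> K" for n
  proof -
    have "{i. i < n \<and> P i} \<subseteq> {..<K}"
      using K not_le by auto
    then show ?thesis
      using card_mono[of "{..<K}"] by fastforce
  qed
  then have "\<forall>\<^sub>F n in sequentially. real (card {i. i < n \<and> P i}) / real n \<le> real K / real n"
    by (intro always_eventually allI divide_right_mono) auto
  then show ?thesis
    by (intro tendsto_sandwich[OF _ _ tendsto_const lim_const_over_n]) auto
qed

lemma density_tendsto_1:
  assumes "\<forall>\<^sub>F i in sequentially. P i"
  shows "(\<lambda>n. real (card {i. i < n \<and> P i}) / real n) \<longlonglongrightarrow> 1"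
proof -
  have split: "card {i. i < n \<and> P i} + card {i. i < n \<and> \<not> P i} = n" for n
  proof -
    have "card {i. i < n \<and> P i} + card {i. i < n \<and> \<not> P i}
        = card ({i. i < n \<and> P i} \<union> {i. i < n \<and> \<not> P i})"
      by (intro card_Un_disjoint[symmetric]) auto
    also have "{i. i < n \<and> P i} \<union> {i. i < n \<and> \<not> P i} = {..<n}"
      by auto
    finally show ?thesis
      by simp
  qed
  \<comment> \<open>At \<open>n = 0\<close> both quotients are 0 by the convention for division,
    hence the restriction to positive \<open>n\<close>.\<close>
  have "1 - real (card {i. i < n \<and> \<not> P i}) / real n = real (card {i. i < n \<and> P i}) / real n"
    if "n > 0" for n
    using that split[of n] by (simp add: field_simps flip: of_nat_add)
  then have "\<forall>\<^sub>F n in sequentially. 1 - real (card {i. i < n \<and> \<not> P i}) / real n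
      = real (card {i. i < n \<and> P i}) / real n"
    using eventually_gt_at_top[of 0] by (rule eventually_mono[rotated])
  moreover have "(\<lambda>n. 1 - real (card {i. i < n \<and> \<not> P i}) / real n) \<longlonglongrightarrow> 1 - 0"
    using assms by (intro tendsto_diff tendsto_const density_tendsto_0) simp
  ultimately show ?thesis
    using Lim_transform_eventually by fastforce
qed

lemma distr_chaotic_pair_not_tendsto_0:
  assumes "distr_chaotic_pair f x y"
  shows "\<not> (\<lambda>n. dist ((f ^^ n) x) ((f ^^ n) y)) \<longlonglongrightarrow> 0"
proof
  assume lim: "(\<lambda>n. dist ((f ^^ n) x) ((f ^^ n) y)) \<longlonglongrightarrow> 0"
  obtain e where e: "e > 0" "lower_distr_fun f x y e = 0"
    using assms by (auto simp: distr_chaotic_pair_def)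
  have "(\<lambda>n. distr_fun f x y n e) \<longlonglongrightarrow> 1"
    unfolding distr_fun_def
    by (intro density_tendsto_1 order_tendstoD(2)[OF lim \<open>e > 0\<close>])
  then have "(\<lambda>n. ereal (distr_fun f x y n e)) \<longlonglongrightarrow> ereal 1"
    by (intro tendsto_ereal)
  from lim_imp_Liminf[OF sequentially_bot this] show False
    using e by (simp add: lower_distr_fun_def)
qed

text \<open>The bound \<open>c\<close> serves as the threshold: \<open>distr_fun\<close> counts
  strict inequalities, so only finitely many indices contribute.\<close>

lemma distr_chaotic_pair_not_bounded_below:
  assumes "distr_chaotic_pair f x y" "c > 0"
  shows "\<not> (\<forall>\<^sub>F n in sequentially. c \<le> dist ((f ^^ n) x) ((f ^^ n) y))"
proof
  assume "\<forall>\<^sub>F n in sequentially. c \<le> dist ((f ^^ n) x) ((f ^^ n) y)"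
  then have "(\<lambda>n. distr_fun f x y n c) \<longlonglongrightarrow> 0"
    unfolding distr_fun_def by (intro density_tendsto_0) (simp add: not_less)
  then have "(\<lambda>n. ereal (distr_fun f x y n c)) \<longlonglongrightarrow> ereal 0"
    by (intro tendsto_ereal)
  from lim_imp_Limsup[OF sequentially_bot this] show False
    using assms by (simp add: distr_chaotic_pair_def upper_distr_fun_def)
qed

text \<open>Supplies one pair of distinct points from an alleged scrambled set; no pair turns out to
  be chaotic.\<close>

lemma uncountable_two_points:
  assumes "uncountable A"
  obtains x y where "x \<in> A" "y \<in> A" "x \<noteq> y"
proof -
  obtain x where "x \<in> A"
    using assms by fastforce
  moreover have "\<not> A \<subseteq> {x}"
    using assms countable_subset by blast
  ultimately show thesis
    using that by blast
qed

theorem proposition3p1: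
  fixes N :: "'a::chilbert_space \<Rightarrow> 'a"
  assumes "separable_space (euclidean :: 'a topology)"
    and "normal_operator N"
  shows "\<not> Li_Yorke_chaotic N \<and> \<not> distributionally_chaotic N \<and> \<not> norm_unimodal N"
proof (intro conjI)
  note normal = \<open>normal_operator N\<close>
  have "\<not> Li_Yorke_pair N x y" for x y
    by (rule normal_dist_cases[OF normal, of x y])
      (use Li_Yorke_pair_not_tendsto_0 Li_Yorke_pair_not_bounded_below in blast)+
  then show "\<not> Li_Yorke_chaotic N"
    unfolding Li_Yorke_chaotic_def by (meson uncountable_two_points)
  have "\<not> distr_chaotic_pair N x y" for x y
    by (rule normal_dist_cases[OF normal, of x y])
      (use distr_chaotic_pair_not_tendsto_0 distr_chaotic_pair_not_bounded_below in blast)+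
  then show "\<not> distributionally_chaotic N"
    unfolding distributionally_chaotic_def by (meson uncountable_two_points)
  show "\<not> norm_unimodal N"
  proof
    assume "norm_unimodal N"
    \<comment> \<open>Taken at \<open>m = 1\<close>: one step of growth by a factor above 1
      contradicts a decreasing orbit, while the limit 0 contradicts a positive lower bound.\<close>
    then obtain r x where r: "r > 1" and x: "x \<noteq> 0"
      and lim: "(\<lambda>k. norm ((N ^^ k) x)) \<longlonglongrightarrow> 0"
      and grow: "\<forall>i\<in>{1..1::nat}. norm ((N ^^ i) x) \<ge> r ^ i * norm x"
      unfolding norm_unimodal_def by blast
    show False
    proof (cases rule: normal_orbit_cases[OF normal, of x])
      case 1
      then have "norm (N x) \<le> norm x"
        using decseq_SucD[of "\<lambda>n. norm ((N ^^ n) x)" 0] by simp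
      moreover have "norm x < r * norm x"
        using r x by simp
      ultimately show False
        using grow by simp
    next
      case (2 c)
      then show False
        using tendsto_lowerbound[OF lim] by force
    qed
  qed
qed

end
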